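(* Let $F$ be a finite field, let $B \subseteq F$ be a subfield such that $F$ has degree $t$ over $B$, and let $\mathcal{C} \subseteq F^n$ be a Reed-Solomon code of dimension $k$. Let $r$ be an integer with $1 \leq r \leq n-k$. Then $\mathcal{C}$ admits an exact centralized repair scheme for $r$ failures with bandwidth $b$ (measured in symbols of $B$) satisfying \[ b \leq \min_{r \le r' \le n-k} \left( (n - r') \left( t - \left\lfloor \log_{|B|}\left( \frac{n - k + r' -1 }{ 2r' - 1 } \right)\right\rfloor \right) \right), \] where the minimum is over integers $r'$.
   Context: Notation: $[n] = \{1,\ldots,n\}$. Reed-Solomon code: for distinct evaluation points $\alpha_1,\ldots,\alpha_n \in F$, the Reed-Solomon code of dimension $k$ ($1 \le k \le n$) over $F$ is $\mathcal{C} = \{ (f(\alpha_1), \ldots, f(\alpha_n)) : f \in F[X],\ \deg(f) < k \} \subseteq F^n$. Exact centralized repair scheme: an exact centralized repair scheme for $r$ failures for $\mathcal{C} \subseteq F^n$ consists of, for each $I \subseteq [n]$ of size at most $r$, a collection of functions $\{ g_{I,j} : j \in [n]\setminus I\}$ with $g_{I,j} : F \to B^{b_{I,j}}$ for some non-negative integers $b_{I,j}$, such that for all $c \in \mathcal{C}$ and all $i \in I$, $c_i$ is determined by $\{ g_{I,j}(c_j) : j \in [n]\setminus I\}$. Its bandwidth (measured relative to $B$) is $\max_{I \subseteq [n], |I| \le r} \sum_{j \in [n]\setminus I} b_{I,j}$. *)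

theory Defs
  imports Complex_Main "HOL-Algebra.Embedded_Algebras" "HOL-Algebra.Polynomial_Divisibility"
begin

text \<open>
  A word of length \<open>n\<close> over an alphabet \<open>A\<close> is an element of \<open>{1..n} \<rightarrow>\<^sub>E A\<close>.
  The library's list polynomials give the zero polynomial degree \<open>0\<close>, so that for \<open>k \<ge> 1\<close>
  the condition \<open>degree p < k\<close> admits it, as it should.
\<close>

definition reed_solomon_code ::
  "('a, 'm) ring_scheme \<Rightarrow> nat \<Rightarrow> nat \<Rightarrow> (nat \<Rightarrow> 'a) \<Rightarrow> (nat \<Rightarrow> 'a) set"
  where "reed_solomon_code F n k \<alpha> =
    {\<lambda>i\<in>{1..n}. ring.eval F p (\<alpha> i) | p. p \<in> carrier (poly_ring F) \<and> degree p < k}"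

text \<open>
  In a scheme \<open>(b, g)\<close>, node \<open>j\<close> holding the symbol \<open>x\<close> sends the word
  \<open>g I j x\<close> of \<open>b I j\<close> symbols of \<open>B\<close> when \<open>I\<close> is the set of failed nodes.
  That \<open>c i\<close> is determined by the words sent means that two codewords for which all these
  words coincide agree at \<open>i\<close>.
\<close>

definition exact_centralized_repair_scheme ::
  "('a, 'm) ring_scheme \<Rightarrow> 'a set \<Rightarrow> nat \<Rightarrow> nat \<Rightarrow> (nat \<Rightarrow> 'a) set \<Rightarrow>
    (nat set \<Rightarrow> nat \<Rightarrow> nat) \<Rightarrow> (nat set \<Rightarrow> nat \<Rightarrow> 'a \<Rightarrow> nat \<Rightarrow> 'a) \<Rightarrow> bool"
  where "exact_centralized_repair_scheme F B n r C b g \<longleftrightarrow>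
    (\<forall>I. I \<subseteq> {1..n} \<and> card I \<le> r \<longrightarrow>
      (\<forall>j\<in>{1..n} - I. g I j \<in> carrier F \<rightarrow> ({1..b I j} \<rightarrow>\<^sub>E B)) \<and>
      (\<forall>c\<in>C. \<forall>c'\<in>C. \<forall>i\<in>I.
        (\<forall>j\<in>{1..n} - I. g I j (c j) = g I j (c' j)) \<longrightarrow> c i = c' i))"

definition repair_bandwidth :: "nat \<Rightarrow> nat \<Rightarrow> (nat set \<Rightarrow> nat \<Rightarrow> nat) \<Rightarrow> nat"
  where "repair_bandwidth n r b =
    Max {(\<Sum>j\<in>{1..n} - I. b I j) | I. I \<subseteq> {1..n} \<and> card I \<le> r}"

end

theory Submission
  imports Defs
begin

text \<open>
  Fix a set \<open>I\<close> of \<open>r\<close> failed nodes, put \<open>A(X) = \<Prod>\<^bsub>i \<in> I\<^esub> (X - \<alpha>\<^sub>i)\<close> and \<open>q = |B|\<close>, and let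
  \<open>L(X) = X M(X)\<close> be a \<open>B\<close>-linear polynomial of degree at most \<open>q\<^sup>s\<close> with \<open>M(0) \<noteq> 0\<close> that kills the
  first \<open>s\<close> elements of a \<open>B\<close>-basis of \<open>F\<close>. For every \<open>h\<close> of degree below \<open>r\<close>, the polynomial
  \<open>P\<^sub>h = L(A h) / A = h M(A h)\<close> has degree at most \<open>q\<^sup>s (2 r - 1) - r\<close>, hence yields a dual codeword
  \<open>(v\<^sub>j P\<^sub>h(\<alpha>\<^sub>j))\<^sub>j\<close>. At a failed node \<open>P\<^sub>h\<close> equals \<open>M(0) h\<close>, and these values are arbitrary; at a
  surviving node it lies in the \<open>(t - s)\<close>-generated \<open>B\<close>-space \<open>L(F) / A(\<alpha>\<^sub>j)\<close>. So if \<open>\<phi> : F \<rightarrow> B\<close> is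
  any nonzero \<open>B\<close>-linear map, the \<open>t - s\<close> symbols \<open>\<phi>(v\<^sub>j A(\<alpha>\<^sub>j)\<^sup>-\<^sup>1 L(u) c\<^sub>j)\<close>, with \<open>u\<close> among the remaining
  basis elements, suffice from node \<open>j\<close>.
\<close>

section \<open>Polynomial functions\<close>

text \<open>\<open>polyfun d f\<close>: on the carrier, \<open>f\<close> agrees with a polynomial of degree at most \<open>d\<close>,
  written in Horner form.\<close>

inductive (in ring) polyfun :: "nat \<Rightarrow> ('a \<Rightarrow> 'a) \<Rightarrow> bool" where
  const: "c \<in> carrier R \<Longrightarrow> (\<And>x. x \<in> carrier R \<Longrightarrow> f x = c) \<Longrightarrow> polyfun d f"
| horner: "polyfun d g \<Longrightarrow> c \<in> carrier R \<Longrightarrow> (\<And>x. x \<in> carrier R \<Longrightarrow> f x = x \<otimes> g x \<oplus> c)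
    \<Longrightarrow> polyfun (Suc d) f"

section \<open>Closure of polynomial functions under the ring operations and composition\<close>

context cring
begin

lemma polyfun_closed: "polyfun d f \<Longrightarrow> x \<in> carrier R \<Longrightarrow> f x \<in> carrier R"
  by (induction rule: polyfun.induct) auto

lemma polyfun_cong:
  assumes "polyfun d f" "\<And>x. x \<in> carrier R \<Longrightarrow> f x = g x"
  shows "polyfun d g"
  using assms(1)
proof cases
  case (const c)
  then show ?thesis using assms(2) by (metis polyfun.const)
next
  case (horner d' g' c)
  show ?thesis unfolding horner(1)
    by (rule polyfun.horner[OF horner(2,3)]) (simp add: assms(2)[symmetric] horner(4))
qed

text \<open>The rule \<open>const\<close> grants a constant every bound \<open>d\<close>, so any
  slack can be absorbed at the innermost level of the Horner form.\<close>

lemma polyfun_mono: "polyfun d f \<Longrightarrow> d \<le> e \<Longrightarrow> polyfun e f"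
proof (induction arbitrary: e rule: polyfun.induct)
  case (const c f d)
  then show ?case by (blast intro: polyfun.const)
next
  case (horner d g c f)
  then obtain e' where e': "e = Suc e'" "d \<le> e'" by (cases e) auto
  show ?case unfolding e'(1)
    by (rule polyfun.horner[OF horner.IH[OF e'(2)] horner.hyps(2,3)])
qed

lemma polyfun_const: "c \<in> carrier R \<Longrightarrow> polyfun d (\<lambda>x. c)"
  by (rule polyfun.const) auto

lemma polyfun_times_id: "polyfun d g \<Longrightarrow> polyfun (Suc d) (\<lambda>x. x \<otimes> g x)"
  by (rule polyfun.horner[of d g \<zero>]) (auto simp: polyfun_closed)

lemma polyfun_add: "polyfun d f \<Longrightarrow> polyfun d g \<Longrightarrow> polyfun d (\<lambda>x. f x \<oplus> g x)"
proof (induction arbitrary: g rule: polyfun.induct)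
  case (const c f d)
  note c = \<open>c \<in> carrier R\<close> and f = const(2)
  from const(3) show ?case
  proof cases
    case (const c')
    show ?thesis by (rule polyfun.const[of "c \<oplus> c'"]) (use c f const in auto)
  next
    case (horner d' g' c')
    show ?thesis unfolding horner(1)
    proof (rule polyfun.horner[OF horner(2), of "c \<oplus> c'"])
      fix x assume x: "x \<in> carrier R"
      then have "g' x \<in> carrier R" using horner(2) by (rule polyfun_closed[rotated])
      then show "f x \<oplus> g x = x \<otimes> g' x \<oplus> (c \<oplus> c')"
        unfolding f[OF x] horner(4)[OF x] using x c horner(3) by algebra
    qed (use c horner in auto)
  qed
next
  case (horner d h c f)
  note c = \<open>c \<in> carrier R\<close> and f = horner(3) and IH = horner(4)
  note h = \<open>polyfun d h\<close>
  from horner(5) show ?case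
  proof cases
    case (const c')
    show ?thesis
    proof (rule polyfun.horner[OF h, of "c \<oplus> c'"])
      fix x assume x: "x \<in> carrier R"
      then have "h x \<in> carrier R" using h by (rule polyfun_closed[rotated])
      then show "f x \<oplus> g x = x \<otimes> h x \<oplus> (c \<oplus> c')"
        unfolding f[OF x] const(2)[OF x] using x c const(1) by algebra
    qed (use c const in auto)
  next
    case (horner g' c')
    show ?thesis
    proof (rule polyfun.horner[OF IH[OF horner(1)], of "c \<oplus> c'"])
      fix x assume x: "x \<in> carrier R"
      then have "h x \<in> carrier R" "g' x \<in> carrier R"
        using h horner(1) by (auto intro: polyfun_closed)
      then show "f x \<oplus> g x = x \<otimes> (h x \<oplus> g' x) \<oplus> (c \<oplus> c')"
        unfolding f[OF x] horner(3)[OF x] using x c horner(2) by algebra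
    qed (use c horner in auto)
  qed
qed

lemma polyfun_smult:
  assumes "a \<in> carrier R"
  shows "polyfun d f \<Longrightarrow> polyfun d (\<lambda>x. a \<otimes> f x)"
proof (induction rule: polyfun.induct)
  case (const c f d)
  show ?case by (rule polyfun.const[of "a \<otimes> c"]) (use const assms in auto)
next
  case (horner d g c f)
  show ?case
  proof (rule polyfun.horner[OF horner(4), of "a \<otimes> c"])
    fix x assume x: "x \<in> carrier R"
    then have "g x \<in> carrier R" using horner(1) by (rule polyfun_closed[rotated])
    then show "a \<otimes> f x = x \<otimes> (a \<otimes> g x) \<oplus> a \<otimes> c"
      unfolding horner(3)[OF x] using x horner(2) assms by algebra
  qed (use horner assms in auto)
qed

lemma polyfun_minus:
  assumes "polyfun d f" "polyfun d g"
  shows "polyfun d (\<lambda>x. f x \<ominus> g x)"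
proof -
  have "polyfun d (\<lambda>x. f x \<oplus> \<ominus> \<one> \<otimes> g x)"
    by (intro polyfun_add polyfun_smult assms) auto
  then show ?thesis
    by (rule polyfun_cong) (use assms in \<open>simp add: polyfun_closed minus_eq l_minus\<close>)
qed

lemma polyfun_mult: "polyfun d f \<Longrightarrow> polyfun e g \<Longrightarrow> polyfun (d + e) (\<lambda>x. f x \<otimes> g x)"
proof (induction rule: polyfun.induct)
  case (const c f d)
  have "polyfun (d + e) (\<lambda>x. c \<otimes> g x)"
    by (rule polyfun_mono[OF polyfun_smult]) (use const in auto)
  then show ?case by (rule polyfun_cong) (simp add: const)
next
  case (horner d h c f)
  have "polyfun (Suc (d + e)) (\<lambda>x. c \<otimes> g x)"
    by (rule polyfun_mono[OF polyfun_smult[OF horner(2) horner.prems]]) simp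
  then have "polyfun (Suc (d + e)) (\<lambda>x. x \<otimes> (h x \<otimes> g x) \<oplus> c \<otimes> g x)"
    by (intro polyfun_add polyfun_times_id horner)
  then show ?case unfolding add_Suc
  proof (rule polyfun_cong)
    fix x assume x: "x \<in> carrier R"
    then have "h x \<in> carrier R" "g x \<in> carrier R"
      using horner(1,5) by (auto intro: polyfun_closed)
    then show "x \<otimes> (h x \<otimes> g x) \<oplus> c \<otimes> g x = f x \<otimes> g x"
      unfolding horner(3)[OF x] using x horner(2) by algebra
  qed
qed

lemma polyfun_comp: "polyfun d f \<Longrightarrow> polyfun e g \<Longrightarrow> polyfun (d * e) (\<lambda>x. f (g x))"
proof (induction rule: polyfun.induct)
  case (const c f d)
  show ?case by (rule polyfun.const[of c]) (use const polyfun_closed in auto)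
next
  case (horner d h c f)
  have "polyfun (e + d * e) (\<lambda>x. g x \<otimes> h (g x) \<oplus> c)"
    by (intro polyfun_add polyfun_mult horner polyfun_const)
  then show ?case unfolding mult_Suc
    by (rule polyfun_cong) (use horner in \<open>simp add: polyfun_closed\<close>)
qed

lemma polyfun_diff_const: "a \<in> carrier R \<Longrightarrow> polyfun 1 (\<lambda>x. x \<ominus> a)"
  unfolding One_nat_def
  by (rule polyfun.horner[OF polyfun_const[of \<one>], of "\<ominus> a"]) (auto simp: minus_eq)

lemma polyfun_plus_const: "a \<in> carrier R \<Longrightarrow> polyfun 1 (\<lambda>x. x \<oplus> a)"
  unfolding One_nat_def by (rule polyfun.horner[OF polyfun_const[of \<one>], of a]) auto

lemma polyfun_finprod:
  assumes "finite S" "a \<in> S \<rightarrow> carrier R"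
  shows "polyfun (card S) (\<lambda>x. \<Otimes>i\<in>S. (x \<ominus> a i))"
  using assms
proof (induction S rule: finite_induct)
  case empty
  then show ?case by (simp add: polyfun_const)
next
  case (insert s S)
  then have "polyfun (1 + card S) (\<lambda>x. (x \<ominus> a s) \<otimes> (\<Otimes>i\<in>S. (x \<ominus> a i)))"
    by (intro polyfun_mult polyfun_diff_const) auto
  then have "polyfun (card (insert s S)) (\<lambda>x. (x \<ominus> a s) \<otimes> (\<Otimes>i\<in>S. (x \<ominus> a i)))"
    using insert by simp
  then show ?case
    by (rule polyfun_cong) (use insert in \<open>auto simp: Pi_iff\<close>)
qed

text \<open>Synthetic division by X - a: if f = X h + c and h = h(a) + (X - a) g, then f = f(a) + (X
  - a) (X g + h(a)). The drop in the bound drives both the root count and the induction for the dual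
  weights.\<close>

lemma polyfun_factor:
  "polyfun (Suc d) f \<Longrightarrow> a \<in> carrier R \<Longrightarrow>
    \<exists>g. polyfun d g \<and> (\<forall>x\<in>carrier R. f x = f a \<oplus> (x \<ominus> a) \<otimes> g x)"
proof (induction d arbitrary: f)
  case 0
  from 0(1) show ?case
  proof cases
    case (const c)
    show ?thesis by (rule exI[of _ "\<lambda>x. \<zero>"]) (use 0 const in \<open>auto intro: polyfun_const\<close>)
  next
    case (horner g c)
    from horner(1) obtain c' where c': "c' \<in> carrier R" "\<And>x. x \<in> carrier R \<Longrightarrow> g x = c'"
      by (auto elim: polyfun.cases)
    have "f x = f a \<oplus> (x \<ominus> a) \<otimes> c'" if "x \<in> carrier R" for x
      unfolding horner(3)[OF that] horner(3)[OF 0(2)] c'(2)[OF that] c'(2)[OF 0(2)]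
      using that 0(2) c' horner(2) by algebra
    then show ?thesis using c' polyfun_const by blast
  qed
next
  case (Suc d)
  note a = \<open>a \<in> carrier R\<close>
  from Suc(2) show ?case
  proof cases
    case (const c)
    show ?thesis by (rule exI[of _ "\<lambda>x. \<zero>"]) (use a const in \<open>auto intro: polyfun_const\<close>)
  next
    case (horner h c)
    note h = horner(1)
    from Suc.IH[OF h a] obtain g where g: "polyfun d g"
      "\<And>x. x \<in> carrier R \<Longrightarrow> h x = h a \<oplus> (x \<ominus> a) \<otimes> g x" by blast
    have ha: "h a \<in> carrier R" using h a by (rule polyfun_closed)
    have "polyfun (Suc d) (\<lambda>x. x \<otimes> g x \<oplus> h a)"
      by (intro polyfun_add polyfun_times_id g polyfun_const ha)
    moreover have "f x = f a \<oplus> (x \<ominus> a) \<otimes> (x \<otimes> g x \<oplus> h a)" if x: "x \<in> carrier R" for x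
    proof -
      have gx: "g x \<in> carrier R" using g(1) x by (rule polyfun_closed)
      show ?thesis
        unfolding horner(3)[OF x] horner(3)[OF a] g(2)[OF x]
        using x a ha gx horner(2) by algebra
    qed
    ultimately show ?thesis by blast
  qed
qed

text \<open>Coefficient lists start with the leading coefficient, so appending an entry is one
  Horner step; hence the induction from the right. The empty list, which is the zero polynomial,
  gets the bound 0.\<close>

lemma polyfun_eval:
  "set p \<subseteq> carrier R \<Longrightarrow> polyfun (length p - 1) (eval p)"
proof (induction p rule: rev_induct)
  case Nil
  then show ?case by (simp add: polyfun_const)
next
  case (snoc b p)
  then have b: "b \<in> carrier R" and p: "set p \<subseteq> carrier R" by auto
  show ?case
  proof (cases "p = []")
    case True
    then show ?thesis using b by (auto intro!: polyfun.const[of b])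
  next
    case False
    have "polyfun (Suc (length p - 1)) (eval (p @ [b]))"
      by (rule polyfun.horner[OF snoc.IH[OF p] b])
        (use b p in \<open>simp add: eval_append_aux eval_in_carrier m_comm\<close>)
    then show ?thesis using False by simp
  qed
qed

lemma finprod_zero:
  assumes "finite A" "f \<in> A \<rightarrow> carrier R" "a \<in> A" "f a = \<zero>"
  shows "(\<Otimes>i\<in>A. f i) = \<zero>"
proof -
  have "(\<Otimes>i\<in>insert a (A - {a}). f i) = f a \<otimes> (\<Otimes>i\<in>A - {a}. f i)"
    by (rule finprod_insert) (use assms in auto)
  moreover have "insert a (A - {a}) = A" using assms by auto
  moreover have "(\<Otimes>i\<in>A - {a}. f i) \<in> carrier R" by (rule finprod_closed) (use assms in auto)
  ultimately show ?thesis using assms by simp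
qed

end

section \<open>Root counting over a domain\<close>

context domain
begin

lemma finprod_nonzero:
  assumes "finite A" "f \<in> A \<rightarrow> carrier R - {\<zero>}"
  shows "(\<Otimes>i\<in>A. f i) \<noteq> \<zero>"
  using assms
proof (induction A rule: finite_induct)
  case (insert a A)
  then have "f \<in> A \<rightarrow> carrier R" "f a \<in> carrier R" "f a \<noteq> \<zero>" "(\<Otimes>i\<in>A. f i) \<noteq> \<zero>" by auto
  then show ?case using insert(1,2) by (simp add: integral_iff finprod_closed)
qed simp

text \<open>Splitting off one root \<open>s\<close> leaves a cofactor with a smaller bound, and in
  the absence of zero divisors this cofactor still vanishes on \<open>S - {s}\<close>.\<close>

lemma polyfun_roots:
  "polyfun d f \<Longrightarrow> finite S \<Longrightarrow> S \<subseteq> carrier R \<Longrightarrow> d < card S \<Longrightarrow> (\<And>s. s \<in> S \<Longrightarrow> f s = \<zero>)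
    \<Longrightarrow> x \<in> carrier R \<Longrightarrow> f x = \<zero>"
proof (induction d arbitrary: f S x)
  case 0
  then obtain s where "s \<in> S" by (metis card.empty all_not_in_conv less_nat_zero_code)
  moreover obtain c where "\<And>x. x \<in> carrier R \<Longrightarrow> f x = c"
    using 0(1) by (auto elim: polyfun.cases)
  ultimately show ?case using 0 by (metis subsetD)
next
  case (Suc d)
  then obtain s where s: "s \<in> S" by (metis card.empty all_not_in_conv less_nat_zero_code)
  with Suc have sc: "s \<in> carrier R" by auto
  from polyfun_factor[OF Suc(2) sc] obtain g where g: "polyfun d g"
    "\<And>x. x \<in> carrier R \<Longrightarrow> f x = f s \<oplus> (x \<ominus> s) \<otimes> g x" by blast
  have fs: "f s = \<zero>" using Suc s by auto
  have f: "f x = (x \<ominus> s) \<otimes> g x" if "x \<in> carrier R" for x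
    using g(2)[OF that] that sc polyfun_closed[OF g(1) that] unfolding fs by simp
  have "g x = \<zero>" if x: "x \<in> carrier R" for x
  proof (rule Suc.IH[OF g(1), of "S - {s}"])
    fix y assume y: "y \<in> S - {s}"
    with Suc have yc: "y \<in> carrier R" by auto
    have "(y \<ominus> s) \<otimes> g y = \<zero>" using f[OF yc] Suc y by auto
    then show "g y = \<zero>"
      using y yc sc polyfun_closed[OF g(1) yc] by (auto simp: integral_iff)
  qed (use Suc s x in auto)
  then show ?case using Suc f sc by simp
qed

end

section \<open>Multipliers of the dual code\<close>

text \<open>The weights \<open>v\<close> are the multipliers of the dual code. A node \<open>a\<close> is added by dividing the
  old weights by \<open>x j \<ominus> x a\<close> and choosing \<open>v a\<close> so that constants are annihilated.\<close>

lemma (in field) dual_weights_exist: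
  assumes "finite S" "S \<noteq> {}" "x \<in> S \<rightarrow> carrier R" "inj_on x S"
  shows "\<exists>v. v \<in> S \<rightarrow> carrier R - {\<zero>} \<and>
    (\<forall>d f. polyfun d f \<longrightarrow> d + 2 \<le> card S \<longrightarrow> (\<Oplus>j\<in>S. v j \<otimes> f (x j)) = \<zero>)"
  using assms
proof (induction S rule: finite_ne_induct)
  case (singleton a)
  \<comment> \<open>With a single node no \<open>d\<close> satisfies \<open>d + 2 \<le> 1\<close>,
    so any nonzero weight will do.\<close>
  show ?case by (rule exI[of _ "\<lambda>_. \<one>"]) auto
next
  case (insert a S)
  then obtain v where v: "v \<in> S \<rightarrow> carrier R - {\<zero>}"
    "\<And>d f. polyfun d f \<Longrightarrow> d + 2 \<le> card S \<Longrightarrow> (\<Oplus>j\<in>S. v j \<otimes> f (x j)) = \<zero>"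
    by (auto simp: Pi_iff)
  have xa: "x a \<in> carrier R" and xS: "\<And>j. j \<in> S \<Longrightarrow> x j \<in> carrier R"
    using insert by auto
  have vS: "\<And>j. j \<in> S \<Longrightarrow> v j \<in> carrier R" "\<And>j. j \<in> S \<Longrightarrow> v j \<noteq> \<zero>" using v by auto
  have dif: "x j \<ominus> x a \<in> carrier R - {\<zero>}" if "j \<in> S" for j
    using that xa xS insert by (auto simp: inj_on_def)
  have unit: "x j \<ominus> x a \<in> Units R" if "j \<in> S" for j
    using dif[OF that] field_Units by auto
  define w0 where "w0 = (\<lambda>j. v j \<otimes> inv (x j \<ominus> x a))"
  define w where "w = w0(a := \<ominus> (\<Oplus>j\<in>S. w0 j))"
  have w0: "w0 j \<in> carrier R" if "j \<in> S" for j
    unfolding w0_def using that vS unit by auto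
  have w0n: "w0 j \<noteq> \<zero>" if "j \<in> S" for j
  proof -
    have "w0 j \<otimes> (x j \<ominus> x a) = v j"
      unfolding w0_def using that vS unit[OF that] dif[OF that] by (simp add: m_assoc)
    then show ?thesis using vS(2)[OF that] dif[OF that] by (metis DiffD1 l_null)
  qed
  have w0s: "(\<Oplus>j\<in>S. w0 j) \<in> carrier R" using w0 by auto
  have wS: "w j = w0 j" if "j \<in> S" for j using that insert unfolding w_def by auto
  have wa: "w a = \<ominus> (\<Oplus>j\<in>S. w0 j)" unfolding w_def by simp
  \<comment> \<open>Expanding f = f(x a) + (X - x a) g cancels the new denominators and leaves the
    old dual relation for g, whose bound is one lower.\<close>
  have ann: "(\<Oplus>j\<in>S. w0 j \<otimes> f (x j)) \<ominus> (\<Oplus>j\<in>S. w0 j) \<otimes> f (x a) = \<zero>"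
    if f: "polyfun d f" and d: "d + 1 \<le> card S" for d f
  proof -
    have fa: "f (x a) \<in> carrier R" using f xa by (rule polyfun_closed)
    have fS: "f (x j) \<in> carrier R" if "j \<in> S" for j using f xS[OF that] by (rule polyfun_closed)
    \<comment> \<open>For \<open>d = 0\<close> the bound \<open>d - 1\<close> truncates to 0, and
      the inductive relation need not cover constants because \<open>S\<close> may be a singleton.
      The quotient is therefore required to be zero in that case.\<close>
    have "\<exists>g. polyfun (d - 1) g \<and> (d = 0 \<longrightarrow> (\<forall>x\<in>carrier R. g x = \<zero>)) \<and>
        (\<forall>y\<in>carrier R. f y = f (x a) \<oplus> (y \<ominus> x a) \<otimes> g y)"
    proof (cases d)
      case 0
      with f obtain c where "\<And>y. y \<in> carrier R \<Longrightarrow> f y = c" by (auto elim: polyfun.cases)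
      then show ?thesis
        by (intro exI[of _ "\<lambda>_. \<zero>"]) (use xa fa in \<open>auto intro: polyfun_const\<close>)
    next
      case (Suc d')
      then show ?thesis using polyfun_factor[of d' f "x a"] f xa by auto
    qed
    then obtain g where g: "polyfun (d - 1) g" "d = 0 \<Longrightarrow> \<forall>x\<in>carrier R. g x = \<zero>"
      "\<And>y. y \<in> carrier R \<Longrightarrow> f y = f (x a) \<oplus> (y \<ominus> x a) \<otimes> g y" by blast
    have gS: "g (x j) \<in> carrier R" if "j \<in> S" for j
      using g(1) xS[OF that] by (rule polyfun_closed)
    have eq: "w0 j \<otimes> f (x j) = w0 j \<otimes> f (x a) \<oplus> v j \<otimes> g (x j)" if j: "j \<in> S" for j
    proof -
      have w0v: "w0 j \<otimes> (x j \<ominus> x a) = v j"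
        unfolding w0_def using j vS unit[OF j] dif[OF j] by (simp add: m_assoc)
      have "w0 j \<otimes> f (x j) = w0 j \<otimes> f (x a) \<oplus> w0 j \<otimes> (x j \<ominus> x a) \<otimes> g (x j)"
        unfolding g(3)[OF xS[OF j]]
        using gS[OF j] fa w0[OF j] dif[OF j] by (simp add: r_distr m_assoc)
      then show ?thesis unfolding w0v .
    qed
    have vg: "(\<Oplus>j\<in>S. v j \<otimes> g (x j)) = \<zero>"
    proof (cases d)
      case 0
      then have "(\<Oplus>j\<in>S. v j \<otimes> g (x j)) = (\<Oplus>j\<in>S. \<zero>)"
        by (intro add.finprod_cong') (use g(2) xS vS in auto)
      then show ?thesis by simp
    next
      case (Suc d')
      then show ?thesis using v(2)[OF g(1)] d by simp
    qed
    have "(\<Oplus>j\<in>S. w0 j \<otimes> f (x j)) = (\<Oplus>j\<in>S. w0 j \<otimes> f (x a) \<oplus> v j \<otimes> g (x j))"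
      by (intro add.finprod_cong') (use eq fa gS w0 vS in auto)
    also have "\<dots> = (\<Oplus>j\<in>S. w0 j \<otimes> f (x a)) \<oplus> (\<Oplus>j\<in>S. v j \<otimes> g (x j))"
      by (rule finsum_addf) (use fa gS w0 vS in auto)
    also have "\<dots> = (\<Oplus>j\<in>S. w0 j) \<otimes> f (x a)"
      unfolding vg using finsum_ldistr[of S "f (x a)" w0] insert(1) fa w0 w0s
      by (simp add: Pi_iff)
    finally show ?thesis using fa w0s by (simp add: r_neg minus_eq)
  qed
  have w_ann: "(\<Oplus>j\<in>insert a S. w j \<otimes> f (x j)) = \<zero>"
    if f: "polyfun d f" and d: "d + 1 \<le> card S" for d f
  proof -
    have fa: "f (x a) \<in> carrier R" using f xa by (rule polyfun_closed)
    have fS: "f (x j) \<in> carrier R" if "j \<in> S" for j using f xS[OF that] by (rule polyfun_closed)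
    have "(\<Oplus>j\<in>insert a S. w j \<otimes> f (x j)) = w a \<otimes> f (x a) \<oplus> (\<Oplus>j\<in>S. w j \<otimes> f (x j))"
      by (rule finsum_insert) (use insert wa wS w0 w0s fa fS in auto)
    also have "(\<Oplus>j\<in>S. w j \<otimes> f (x j)) = (\<Oplus>j\<in>S. w0 j \<otimes> f (x j))"
      by (intro add.finprod_cong') (use wS w0 fS in auto)
    also have "w a \<otimes> f (x a) \<oplus> \<dots> = \<dots> \<ominus> (\<Oplus>j\<in>S. w0 j) \<otimes> f (x a)"
      unfolding wa using fa w0s w0 fS
      by (subst a_comm) (auto simp: minus_eq l_minus)
    finally show ?thesis using ann[OF f d] by simp
  qed
  \<comment> \<open>If the new weight were zero, the \<open>w0 j\<close> would sum to zero. Testing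
    \<open>ann\<close> on the polynomial that vanishes at every node of \<open>S\<close> except
    \<open>i\<close> would then force \<open>w0 i\<close> to be zero.\<close>
  have wan: "w a \<noteq> \<zero>"
  proof
    assume w0a: "w a = \<zero>"
    then have sum0: "(\<Oplus>j\<in>S. w0 j) = \<zero>" unfolding wa using w0s by simp
    obtain i where i: "i \<in> S" using insert by auto
    define f where "f = (\<lambda>y. \<Otimes>l\<in>S - {i}. (y \<ominus> x l))"
    have f: "polyfun (card (S - {i})) f"
      unfolding f_def by (rule polyfun_finprod) (use insert xS in auto)
    have cS: "card (S - {i}) + 1 \<le> card S"
      using i insert(1) by (metis Suc_eq_plus1 card_Suc_Diff1 order_refl)
    have fS: "f (x j) \<in> carrier R" if "j \<in> S" for j using f xS[OF that] by (rule polyfun_closed)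
    have f0: "f (x j) = \<zero>" if "j \<in> S - {i}" for j
      unfolding f_def by (rule finprod_zero[of _ _ j]) (use that insert xS in auto)
    have fi: "f (x i) \<noteq> \<zero>"
      unfolding f_def by (rule finprod_nonzero) (use i insert xS in \<open>auto simp: inj_on_def\<close>)
    have fa: "f (x a) \<in> carrier R" using f xa by (rule polyfun_closed)
    have "(\<Oplus>j\<in>S. w0 j \<otimes> f (x j)) = \<zero>"
      using ann[OF f cS] fa w0 fS unfolding sum0 by (simp add: minus_eq)
    moreover have "(\<Oplus>j\<in>S. w0 j \<otimes> f (x j)) = (\<Oplus>j\<in>S. if i = j then w0 j \<otimes> f (x j) else \<zero>)"
      by (intro add.finprod_cong') (use w0 fS f0 in auto)
    moreover have "\<dots> = w0 i \<otimes> f (x i)"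
      by (rule add.finprod_singleton[OF i insert(1)]) (use w0 fS in auto)
    ultimately show False using w0n[OF i] w0[OF i] fi fS[OF i] by (simp add: integral_iff)
  qed
  show ?case
  proof (intro exI[of _ w] conjI allI impI)
    show "w \<in> insert a S \<rightarrow> carrier R - {\<zero>}"
      using wan wa w0s wS w0 w0n by auto
  qed (use w_ann insert in auto)
qed

section \<open>Linearised polynomials\<close>

definition (in ring) linear_over :: "'a set \<Rightarrow> ('a \<Rightarrow> 'a) \<Rightarrow> bool" where
  "linear_over K f \<longleftrightarrow> f \<in> carrier R \<rightarrow> carrier R \<and>
    (\<forall>x\<in>carrier R. \<forall>y\<in>carrier R. f (x \<oplus> y) = f x \<oplus> f y) \<and>
    (\<forall>k\<in>K. \<forall>x\<in>carrier R. f (k \<otimes> x) = k \<otimes> f x)"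

context ring
begin

lemma linear_over_closed: "linear_over K f \<Longrightarrow> x \<in> carrier R \<Longrightarrow> f x \<in> carrier R"
  and linear_over_add:
    "linear_over K f \<Longrightarrow> x \<in> carrier R \<Longrightarrow> y \<in> carrier R \<Longrightarrow> f (x \<oplus> y) = f x \<oplus> f y"
  and linear_over_smult:
    "linear_over K f \<Longrightarrow> k \<in> K \<Longrightarrow> x \<in> carrier R \<Longrightarrow> f (k \<otimes> x) = k \<otimes> f x"
  unfolding linear_over_def by auto

lemma linear_over_zero: "linear_over K f \<Longrightarrow> f \<zero> = \<zero>"
proof -
  assume f: "linear_over K f"
  have "f \<zero> \<oplus> f \<zero> = f \<zero> \<oplus> \<zero>"
    using linear_over_add[OF f, of \<zero> \<zero>] linear_over_closed[OF f, of \<zero>] by simp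
  then show ?thesis using linear_over_closed[OF f, of \<zero>] by (simp only: add.l_cancel zero_closed)
qed

lemma linear_over_uminus:
  "linear_over K f \<Longrightarrow> x \<in> carrier R \<Longrightarrow> f (\<ominus> x) = \<ominus> f x"
proof -
  assume f: "linear_over K f" and x: "x \<in> carrier R"
  have "f (\<ominus> x) \<oplus> f x = \<zero>"
    using linear_over_add[OF f, of "\<ominus> x" x] linear_over_zero[OF f] x by (simp add: l_neg)
  then show ?thesis using linear_over_closed[OF f] x by (intro minus_equality[symmetric]) auto
qed

lemma linear_over_minus:
  "linear_over K f \<Longrightarrow> x \<in> carrier R \<Longrightarrow> y \<in> carrier R \<Longrightarrow> f (x \<ominus> y) = f x \<ominus> f y"
  unfolding minus_eq by (simp add: linear_over_add linear_over_uminus)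

lemma linear_over_finsum:
  assumes "linear_over K f" "finite S" "a \<in> S \<rightarrow> carrier R"
  shows "f (\<Oplus>i\<in>S. a i) = (\<Oplus>i\<in>S. f (a i))"
  using assms(2,3)
proof (induction S rule: finite_induct)
  case empty
  show ?case using linear_over_zero[OF assms(1)] by simp
next
  case (insert s S)
  then have "a s \<in> carrier R" "(\<Oplus>i\<in>S. a i) \<in> carrier R" by auto
  then show ?case
    using insert linear_over_add[OF assms(1)] linear_over_closed[OF assms(1)]
    by (simp add: Pi_iff)
qed

lemma linear_over_comp: "linear_over K f \<Longrightarrow> linear_over K g \<Longrightarrow> linear_over K (\<lambda>x. f (g x))"
  unfolding linear_over_def by (simp add: Pi_iff)

lemma linear_over_Span_zero:
  assumes "linear_over K f" "K \<subseteq> carrier R" "set Us \<subseteq> carrier R" "\<And>u. u \<in> set Us \<Longrightarrow> f u = \<zero>"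
    and "y \<in> Span K Us"
  shows "f y = \<zero>"
  using assms(3-5)
proof (induction Us arbitrary: y)
  case Nil
  then show ?case using linear_over_zero[OF assms(1)] by simp
next
  case (Cons u Us)
  then obtain k v where kv: "k \<in> K" "v \<in> Span K Us" "y = k \<otimes> u \<oplus> v"
    by (auto simp: line_extension_mem_iff)
  moreover from this have "v \<in> carrier R" using Span_in_carrier[OF assms(2), of Us] Cons by auto
  moreover have "k \<in> carrier R" using kv assms(2) by auto
  ultimately show ?case
    using Cons linear_over_add[OF assms(1)] linear_over_smult[OF assms(1)] by simp
qed

text \<open>An element of the span is given by its coefficients. For a spanning list of the whole
  field this yields |F| \<le> |B|^t, from which \<open>s \<le> t\<close> is later deduced.\<close>

lemma card_Span_le:
  assumes "finite K"
  shows "finite (Span K Us) \<and> card (Span K Us) \<le> card K ^ length Us"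
proof (induction Us)
  case (Cons u Us)
  have *: "Span K (u # Us) = (\<lambda>(k, v). k \<otimes> u \<oplus> v) ` (K \<times> Span K Us)"
    by (force simp: line_extension_mem_iff)
  have fin: "finite (K \<times> Span K Us)" using Cons assms by auto
  have "card (Span K (u # Us)) \<le> card (K \<times> Span K Us)"
    unfolding * by (rule card_image_le[OF fin])
  also have "\<dots> \<le> card K * card K ^ length Us"
    using Cons by (simp add: card_cartesian_product)
  finally show ?case using fin * by simp
qed simp

end

section \<open>A nonzero functional, and linearised polynomials with prescribed roots\<close>

context field
begin

lemma linear_over_smult_comp:
  assumes "a \<in> carrier R" "K \<subseteq> carrier R" "linear_over K f"
  shows "linear_over K (\<lambda>x. a \<otimes> f x)"
  using assms unfolding linear_over_def by (auto simp: Pi_iff r_distr subset_iff m_lcomm)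

lemma linear_over_comp_smult:
  assumes "a \<in> carrier R" "K \<subseteq> carrier R" "linear_over K f"
  shows "linear_over K (\<lambda>x. f (a \<otimes> x))"
  using assms unfolding linear_over_def by (auto simp: Pi_iff r_distr subset_iff m_lcomm)

text \<open>The coordinate of the first basis vector \<open>u\<close>: every element is k u + v with
  v in the span of the other basis vectors, and k is unique because \<open>u\<close> lies outside
  that span. This functional takes the place usually given to the field trace.\<close>

lemma coordinate_functional_exists:
  assumes K: "subfield K R" and dim: "dimension t K (carrier R)"
  shows "\<exists>f. linear_over K f \<and> f \<in> carrier R \<rightarrow> K \<and> (\<exists>x\<in>carrier R. f x \<noteq> \<zero>)"
proof -
  obtain Us where Us: "set Us \<subseteq> carrier R" "independent K Us" "Span K Us = carrier R"
    using exists_base[OF K dim] by auto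
  have "Us \<noteq> []" using Us(3) one_closed one_not_zero by (metis Span.simps foldr_Nil id_apply singletonD)
  then obtain u Vs where uV: "Us = u # Vs" by (cases Us) auto
  have u: "u \<in> carrier R" "u \<notin> Span K Vs" and V: "set Vs \<subseteq> carrier R"
    using Us independent_backwards[of K u Vs] unfolding uV by auto
  note Kc = subringE[OF subfieldE(1)[OF K]]
  note Vp = Span_subgroup_props[OF K V] Span_smult_closed[OF K V]
  have decomp: "\<exists>k\<in>K. \<exists>v\<in>Span K Vs. x = k \<otimes> u \<oplus> v" if "x \<in> carrier R" for x
    using that Us(3)[symmetric] unfolding uV by (auto simp: line_extension_mem_iff)
  have uniq: "k = k'" if "k \<in> K" "k' \<in> K" "v \<in> Span K Vs" "v' \<in> Span K Vs"
    "k \<otimes> u \<oplus> v = k' \<otimes> u \<oplus> v'" for k k' v v'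
  proof (rule ccontr)
    assume "k \<noteq> k'"
    have c: "k \<in> carrier R" "k' \<in> carrier R" "v \<in> carrier R" "v' \<in> carrier R"
      using that Kc(1) Vp(1) by auto
    have "(k \<ominus> k') \<otimes> u = (k \<otimes> u \<oplus> v) \<ominus> k' \<otimes> u \<ominus> v" using c u by algebra
    also have "\<dots> = v' \<ominus> v" unfolding that(5) using c u by algebra
    finally have "(k \<ominus> k') \<otimes> u \<in> Span K Vs" using that Vp(3,4) by (simp add: minus_eq)
    moreover have "k \<ominus> k' \<in> K - {\<zero>}"
    proof -
      have "k \<ominus> k' \<noteq> \<zero>" using \<open>k \<noteq> k'\<close> c by (simp only: r_right_minus_eq not_False_eq_True)
      then show ?thesis using that Kc by (simp add: minus_eq)
    qed
    ultimately show False using Span_m_inv_simprule[OF K V, of "k \<ominus> k'" u] u by blast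
  qed
  define f where "f x = (THE k. k \<in> K \<and> (\<exists>v\<in>Span K Vs. x = k \<otimes> u \<oplus> v))" for x
  have f: "f (k \<otimes> u \<oplus> v) = k" if "k \<in> K" "v \<in> Span K Vs" for k v
    unfolding f_def by (rule the_equality) (use that uniq in blast)+
  have "linear_over K f" unfolding linear_over_def
  proof (intro conjI ballI)
    show "f \<in> carrier R \<rightarrow> carrier R" using decomp f Kc(1) by fastforce
    fix x assume "x \<in> carrier R"
    with decomp obtain k v where x: "k \<in> K" "v \<in> Span K Vs" "x = k \<otimes> u \<oplus> v" by blast
    then have c: "k \<in> carrier R" "v \<in> carrier R" using Kc(1) Vp(1) by auto
    {
      fix y assume "y \<in> carrier R"
      with decomp obtain l w where y: "l \<in> K" "w \<in> Span K Vs" "y = l \<otimes> u \<oplus> w" by blast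
      then have d: "l \<in> carrier R" "w \<in> carrier R" using Kc(1) Vp(1) by auto
      have "x \<oplus> y = (k \<oplus> l) \<otimes> u \<oplus> (v \<oplus> w)" unfolding x y using c d u by algebra
      then show "f (x \<oplus> y) = f x \<oplus> f y" using x y f Kc Vp by simp
    }
    fix l assume l: "l \<in> K"
    then have lc: "l \<in> carrier R" using Kc(1) by auto
    have "l \<otimes> x = (l \<otimes> k) \<otimes> u \<oplus> (l \<otimes> v)" unfolding x using c lc u by algebra
    then show "f (l \<otimes> x) = l \<otimes> f x" using x l f Kc Vp by simp
  qed
  moreover have "f \<in> carrier R \<rightarrow> K" using decomp f by fastforce
  moreover have "f u \<noteq> \<zero>" using f[of \<one> \<zero>] Kc Vp u by simp
  ultimately show ?thesis using u by blast
qed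

text \<open>A monic polynomial and its translate have the same leading term, so their difference
  drops in degree. A further factor X - s turns the difference into (X - s) (P(X + y) - P(X)) + y
  P(X + y), which gives the induction.\<close>

lemma polyfun_shift_diff:
  assumes "finite S" "S \<noteq> {}" "S \<subseteq> carrier R" "y \<in> carrier R"
  shows "polyfun (card S - 1) (\<lambda>x. (\<Otimes>b\<in>S. (x \<oplus> y \<ominus> b)) \<ominus> (\<Otimes>b\<in>S. (x \<ominus> b)))"
  using assms
proof (induction S rule: finite_ne_induct)
  case (singleton s)
  have *: "(\<Otimes>b\<in>{s}. (z \<ominus> b)) = z \<ominus> s" if "z \<in> carrier R" for z
    using that singleton by simp
  show ?case
  proof (rule polyfun.const[of y])
    fix x assume x: "x \<in> carrier R"
    have "s \<in> carrier R" and y: "y \<in> carrier R" using singleton by auto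
    then have "(x \<oplus> y \<ominus> s) \<ominus> (x \<ominus> s) = y" using x by algebra
    then show "(\<Otimes>b\<in>{s}. (x \<oplus> y \<ominus> b)) \<ominus> (\<Otimes>b\<in>{s}. (x \<ominus> b)) = y"
      using *[OF x] *[of "x \<oplus> y"] x y by simp
  qed (use singleton in auto)
next
  case (insert s S)
  then have s: "s \<in> carrier R" and S: "S \<subseteq> carrier R" by auto
  define P where "P = (\<lambda>x. \<Otimes>b\<in>S. (x \<ominus> b))"
  have P: "polyfun (card S) P" unfolding P_def
    by (rule polyfun_finprod[of S "\<lambda>b. b"]) (use insert in auto)
  have "polyfun (card S * 1) (\<lambda>x. P (x \<oplus> y))"
    by (rule polyfun_comp[OF P polyfun_plus_const]) (use insert in auto)
  then have Py: "polyfun (card S) (\<lambda>x. P (x \<oplus> y))" by simp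
  have "polyfun (1 + (card S - 1)) (\<lambda>x. (x \<ominus> s) \<otimes> (P (x \<oplus> y) \<ominus> P x))"
    unfolding P_def
    by (intro polyfun_mult polyfun_diff_const insert.IH) (use insert in auto)
  moreover have "1 + (card S - 1) = card S"
    using insert by (simp add: card_gt_0_iff)
  ultimately have "polyfun (card S) (\<lambda>x. (x \<ominus> s) \<otimes> (P (x \<oplus> y) \<ominus> P x))" by simp
  then have "polyfun (card S) (\<lambda>x. (x \<ominus> s) \<otimes> (P (x \<oplus> y) \<ominus> P x) \<oplus> y \<otimes> P (x \<oplus> y))"
    by (intro polyfun_add polyfun_smult Py) (use insert in auto)
  moreover have "(x \<ominus> s) \<otimes> (P (x \<oplus> y) \<ominus> P x) \<oplus> y \<otimes> P (x \<oplus> y) =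
      (\<Otimes>b\<in>insert s S. (x \<oplus> y \<ominus> b)) \<ominus> (\<Otimes>b\<in>insert s S. (x \<ominus> b))"
    if x: "x \<in> carrier R" for x
  proof -
    have c: "P x \<in> carrier R" "P (x \<oplus> y) \<in> carrier R"
      using polyfun_closed[OF P] x insert by auto
    have 1: "(\<Otimes>b\<in>insert s S. (z \<ominus> b)) = (z \<ominus> s) \<otimes> P z" if "z \<in> carrier R" for z
      unfolding P_def by (rule finprod_insert) (use insert that in auto)
    show ?thesis using 1[OF x] 1[of "x \<oplus> y"] x insert(6) s c
      by simp algebra
  qed
  ultimately show ?case
    using insert(1,3) by (auto intro: polyfun_cong)
qed

text \<open>The polynomial \<open>X\<^sup>q - X = \<Prod>\<^bsub>b \<in> K\<^esub> (X - b)\<close> is treated through its roots, so that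
  nothing about the characteristic is needed: additivity holds because
  \<open>E(x + y) - E(x) - E(y)\<close> has degree below \<open>q\<close> in \<open>x\<close> and vanishes on \<open>K\<close>, and
  \<open>k\<^bsup>q-1\<^esup> = 1\<close> is read off \<open>M(k x) = k\<^bsup>q-1\<^esup> M(x)\<close> at \<open>x = 0\<close>.\<close>

lemma subfield_polynomial_linear:
  assumes K: "subfield K R" and fin: "finite K"
  shows "\<exists>M. polyfun (card K - 1) M \<and> M \<zero> \<noteq> \<zero> \<and> M \<one> = \<zero> \<and> linear_over K (\<lambda>x. x \<otimes> M x)"
proof -
  note Kc = subringE[OF subfieldE(1)[OF K]]
  have Kcar: "b \<in> carrier R" if "b \<in> K" for b using Kc(1) that by auto
  define M where "M = (\<lambda>x. \<Otimes>b\<in>K - {\<zero>}. (x \<ominus> b))"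
  define E where "E = (\<lambda>x. \<Otimes>b\<in>K. (x \<ominus> b))"
  have "polyfun (card (K - {\<zero>})) M"
    unfolding M_def by (rule polyfun_finprod[of _ "\<lambda>b. b"]) (use fin Kcar in auto)
  then have M: "polyfun (card K - 1) M" using Kc(2) fin by simp
  have Mc: "M x \<in> carrier R" if "x \<in> carrier R" for x using M that by (rule polyfun_closed)
  have M0: "M \<zero> \<noteq> \<zero>"
    unfolding M_def by (rule finprod_nonzero) (use fin Kcar in \<open>auto simp: minus_eq\<close>)
  \<comment> \<open>This root lets the later construction kill a new element once that element has
    been scaled to \<open>\<one>\<close>.\<close>
  have M1: "M \<one> = \<zero>"
    unfolding M_def
    by (rule finprod_zero[of _ _ \<one>]) (use fin Kcar Kc one_not_zero in \<open>auto simp: minus_eq r_neg\<close>)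
  have EM: "E x = x \<otimes> M x" if x: "x \<in> carrier R" for x
  proof -
    have "(\<Otimes>b\<in>insert \<zero> (K - {\<zero>}). (x \<ominus> b)) = (x \<ominus> \<zero>) \<otimes> M x"
      unfolding M_def by (rule finprod_insert) (use fin Kcar x in auto)
    moreover have "insert \<zero> (K - {\<zero>}) = K" using Kc(2) by auto
    moreover have "x \<ominus> \<zero> = x" using x by (simp add: minus_eq)
    ultimately show ?thesis unfolding E_def by simp
  qed
  have E: "polyfun (card K) E"
    unfolding E_def by (rule polyfun_finprod[of _ "\<lambda>b. b"]) (use fin Kcar in auto)
  have Ec: "E x \<in> carrier R" if "x \<in> carrier R" for x using E that by (rule polyfun_closed)
  have EK: "E k = \<zero>" if "k \<in> K" for k
    unfolding E_def by (rule finprod_zero[of _ _ k]) (use fin Kcar that in \<open>auto simp: minus_eq r_neg\<close>)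
  \<comment> \<open>Translation by \<open>k\<close> permutes \<open>K\<close>, hence the linear
    factors of \<open>E\<close>.\<close>
  have Eshift: "E (k \<oplus> x) = E x" if k: "k \<in> K" and x: "x \<in> carrier R" for k x
  proof -
    let ?h = "\<lambda>b. k \<oplus> b"
    have inj: "inj_on ?h K" using Kcar k by (auto simp: inj_on_def)
    have im: "?h ` K = K" by (rule endo_inj_surj[OF fin _ inj]) (use k Kc in auto)
    have "E (k \<oplus> x) = (\<Otimes>b\<in>?h ` K. (k \<oplus> x \<ominus> b))" unfolding E_def im ..
    also have "\<dots> = (\<Otimes>b\<in>K. (k \<oplus> x \<ominus> ?h b))"
      by (rule finprod_reindex[OF _ inj]) (use Kcar k x in auto)
    also have "\<dots> = E x" unfolding E_def
    proof (rule finprod_cong')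
      fix b assume "b \<in> K"
      then have "b \<in> carrier R" by (rule Kcar)
      then show "k \<oplus> x \<ominus> (k \<oplus> b) = x \<ominus> b" using Kcar[OF k] x by algebra
    qed (use Kcar x in auto)
    finally show ?thesis .
  qed
  have Eadd: "E (x \<oplus> y) = E x \<oplus> E y" if x: "x \<in> carrier R" and y: "y \<in> carrier R" for x y
  proof -
    have "polyfun (card K - 1) (\<lambda>x. E (x \<oplus> y) \<ominus> E x \<ominus> E y)"
      unfolding E_def
      by (intro polyfun_minus[OF polyfun_shift_diff] polyfun_const finprod_closed)
        (use fin Kc Kcar y in auto)
    then have "E (x \<oplus> y) \<ominus> E x \<ominus> E y = \<zero>"
    proof (rule polyfun_roots[OF _ fin Kc(1) _ _ x])
      have "card K > 0" using fin Kc(2) by (metis card_gt_0_iff empty_iff)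
      then show "card K - 1 < card K" by simp
      fix k assume k: "k \<in> K"
      show "E (k \<oplus> y) \<ominus> E k \<ominus> E y = \<zero>"
        unfolding Eshift[OF k y] EK[OF k] using Ec[OF y] by algebra
    qed
    then have "(E (x \<oplus> y) \<ominus> E x \<ominus> E y) \<oplus> (E x \<oplus> E y) = E x \<oplus> E y"
      using Ec x y by simp
    moreover have "(E (x \<oplus> y) \<ominus> E x \<ominus> E y) \<oplus> (E x \<oplus> E y) = E (x \<oplus> y)"
      using Ec[OF x] Ec[OF y] Ec[of "x \<oplus> y"] x y by algebra
    ultimately show ?thesis by simp
  qed
  have Mhom: "M (k \<otimes> x) = M x" if k: "k \<in> K - {\<zero>}" and x: "x \<in> carrier R" for k x
  proof -
    let ?h = "\<lambda>b. k \<otimes> b"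
    let ?c = "\<Otimes>b\<in>K - {\<zero>}. k"
    have kc: "k \<in> carrier R" "k \<noteq> \<zero>" using k Kcar by auto
    have inj: "inj_on ?h (K - {\<zero>})" using Kcar kc by (auto simp: inj_on_def m_lcancel)
    have im: "?h ` (K - {\<zero>}) = K - {\<zero>}"
      by (rule endo_inj_surj[OF _ _ inj]) (use fin k kc Kcar Kc in \<open>auto simp: integral_iff\<close>)
    have cc: "?c \<in> carrier R" using kc by auto
    have *: "M (k \<otimes> z) = ?c \<otimes> M z" if z: "z \<in> carrier R" for z
    proof -
      have "M (k \<otimes> z) = (\<Otimes>b\<in>?h ` (K - {\<zero>}). (k \<otimes> z \<ominus> b))" unfolding M_def im ..
      also have "\<dots> = (\<Otimes>b\<in>K - {\<zero>}. (k \<otimes> z \<ominus> ?h b))"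
        by (rule finprod_reindex[OF _ inj]) (use Kcar kc z in auto)
      also have "\<dots> = (\<Otimes>b\<in>K - {\<zero>}. k \<otimes> (z \<ominus> b))"
      proof (rule finprod_cong')
        fix b assume "b \<in> K - {\<zero>}"
        then have "b \<in> carrier R" using Kcar by simp
        then show "k \<otimes> z \<ominus> k \<otimes> b = k \<otimes> (z \<ominus> b)" using kc(1) z by algebra
      qed (use Kcar kc z in auto)
      also have "\<dots> = ?c \<otimes> M z"
        unfolding M_def by (rule finprod_multf) (use Kcar kc z in auto)
      finally show ?thesis .
    qed
    have "\<one> \<otimes> M \<zero> = ?c \<otimes> M \<zero>" using *[of \<zero>] kc Mc[of \<zero>] by simp
    then have "?c = \<one>" using m_rcancel[OF M0 Mc[OF zero_closed] one_closed cc] by simp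
    then show ?thesis using *[OF x] Mc[OF x] by simp
  qed
  have "linear_over K (\<lambda>x. x \<otimes> M x)"
    unfolding linear_over_def
  proof (intro conjI ballI)
    fix k x assume k: "k \<in> K" and x: "x \<in> carrier R"
    show "k \<otimes> x \<otimes> M (k \<otimes> x) = k \<otimes> (x \<otimes> M x)"
    proof (cases "k = \<zero>")
      case False
      then show ?thesis using Mhom[of k x] k x Kcar Mc by (simp add: m_assoc)
    qed (use x Mc in simp)
  qed (use EM Eadd Mc in auto)
  then show ?thesis using M M0 M1 by blast
qed

text \<open>One element is added at a time. If L = X M does not yet kill \<open>u\<close>, scale it
  so that L(u) = 1 and compose with E = X N, the polynomial whose roots are the elements of
  \<open>K\<close>: E(L(X)) is again linear, still kills the earlier elements, and kills
  \<open>u\<close> because E(1) = 0. Its degree is at most q times the old bound, and its cofactor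
  at 0 is a M(0) N(0), which is nonzero.\<close>

lemma linearised_polynomial_exists:
  assumes K: "subfield K R" and fin: "finite K" and Us: "set Us \<subseteq> carrier R"
  shows "\<exists>M. polyfun (card K ^ length Us - 1) M \<and> M \<zero> \<noteq> \<zero> \<and>
    linear_over K (\<lambda>x. x \<otimes> M x) \<and> (\<forall>u\<in>set Us. u \<otimes> M u = \<zero>)"
  using Us
proof (induction Us)
  case Nil
  have "linear_over K (\<lambda>x. x \<otimes> \<one>)"
    using subringE(1)[OF subfieldE(1)[OF K]] unfolding linear_over_def by (simp add: subset_iff)
  then show ?case by (intro exI[of _ "\<lambda>_. \<one>"]) (simp add: polyfun_const)
next
  case (Cons u Us)
  then obtain M where M: "polyfun (card K ^ length Us - 1) M" "M \<zero> \<noteq> \<zero>"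
    "linear_over K (\<lambda>x. x \<otimes> M x)" "\<And>v. v \<in> set Us \<Longrightarrow> v \<otimes> M v = \<zero>" by auto
  note Kc = subringE[OF subfieldE(1)[OF K]]
  have u: "u \<in> carrier R" using Cons by simp
  have Mc: "M x \<in> carrier R" if "x \<in> carrier R" for x using M(1) that by (rule polyfun_closed)
  have q: "card K > 0" using fin Kc(2) by (metis card_gt_0_iff empty_iff)
  let ?Q = "card K ^ length Us"
  have Q: "?Q > 0" using q by simp
  show ?case
  proof (cases "u \<otimes> M u = \<zero>")
    case True
    have "polyfun (card K ^ length (u # Us) - 1) M"
      by (rule polyfun_mono[OF M(1)]) (intro diff_le_mono power_increasing, use q in auto)
    then show ?thesis using M True by auto
  next
    case False
    obtain N where N: "polyfun (card K - 1) N" "N \<zero> \<noteq> \<zero>" "N \<one> = \<zero>"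
      "linear_over K (\<lambda>x. x \<otimes> N x)"
      using subfield_polynomial_linear[OF K fin] by blast
    have Nc: "N x \<in> carrier R" if "x \<in> carrier R" for x using N(1) that by (rule polyfun_closed)
    define a where "a = inv (u \<otimes> M u)"
    have uM: "u \<otimes> M u \<in> Units R" using False u Mc field_Units by auto
    then have a: "a \<in> carrier R" "a \<otimes> (u \<otimes> M u) = \<one>"
      unfolding a_def by (rule Units_inv_closed, rule Units_l_inv)
    have a0: "a \<noteq> \<zero>"
    proof
      assume "a = \<zero>"
      then show False using a(2) l_null[OF m_closed[OF u Mc[OF u]]] one_not_zero by simp
    qed
    define L where "L = (\<lambda>x. a \<otimes> (x \<otimes> M x))"
    have L: "linear_over K L"
      unfolding L_def by (rule linear_over_smult_comp[OF a(1) Kc(1) M(3)])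
    have Lp: "polyfun ?Q L"
    proof -
      have "polyfun (Suc (?Q - 1)) L"
        unfolding L_def by (intro polyfun_smult polyfun_times_id a M)
      then show ?thesis using Q by simp
    qed
    have Lc: "L x \<in> carrier R" if "x \<in> carrier R" for x using Lp that by (rule polyfun_closed)
    \<comment> \<open>This is L(X) N(L(X)) divided by X: the factor \<open>a \<otimes> M x\<close>
      is the quotient of L by X, so no inverse of \<open>x\<close> occurs and the value at
      \<open>\<zero>\<close> makes sense.\<close>
    define M' where "M' = (\<lambda>x. (a \<otimes> M x) \<otimes> N (L x))"
    have LM': "x \<otimes> M' x = L x \<otimes> N (L x)" if x: "x \<in> carrier R" for x
    proof -
      have "x \<otimes> (a \<otimes> m \<otimes> l) = a \<otimes> (x \<otimes> m) \<otimes> l" if "m \<in> carrier R" "l \<in> carrier R" for m l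
        using that x a(1) by algebra
      from this[OF Mc[OF x] Nc[OF Lc[OF x]]] show ?thesis unfolding M'_def L_def .
    qed
    have "polyfun ((?Q - 1) + (card K - 1) * ?Q) M'"
      unfolding M'_def by (intro polyfun_mult polyfun_smult polyfun_comp a M N Lp)
    moreover have "(?Q - 1) + (card K - 1) * ?Q = card K ^ length (u # Us) - 1"
    proof -
      obtain c where "card K = Suc c" using q by (cases "card K") auto
      then show ?thesis using Q by simp
    qed
    ultimately have "polyfun (card K ^ length (u # Us) - 1) M'" by simp
    moreover have "M' \<zero> \<noteq> \<zero>"
      unfolding M'_def L_def using a a0 M N Mc Nc by (simp add: integral_iff)
    moreover have "linear_over K (\<lambda>x. x \<otimes> M' x)"
      using linear_over_comp[OF N(4) L] LM' unfolding linear_over_def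
      by (simp add: Pi_iff Kc(1)[THEN subsetD])
    moreover have "v \<otimes> M' v = \<zero>" if v: "v \<in> set (u # Us)" for v
    proof -
      have vc: "v \<in> carrier R" using v Cons by auto
      have "L v = \<one> \<or> L v = \<zero>" unfolding L_def using v M(4) a by auto
      then show ?thesis unfolding LM'[OF vc] using N(3) Nc by auto
    qed
    ultimately show ?thesis by blast
  qed
qed

end

section \<open>The repair scheme\<close>

text \<open>Every download is additive in the symbol, so it suffices to treat the difference e = f -
  f', for which all downloads vanish. For nonempty \<open>I\<close> the first two terms of
  \<open>deg\<close> add up to q^s (2 |I| - 1) - |I|, the bound for P_h; then \<open>d\<close>
  accounts for e and 2 is the margin in the dual relation.\<close>

lemma (in field) repair_functions_exist:
  assumes K: "subfield K R" and finK: "finite K" and dim: "dimension t K (carrier R)"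
    and finS: "finite S" and \<alpha>: "\<alpha> \<in> S \<rightarrow> carrier R" "inj_on \<alpha> S"
    and I: "I \<subseteq> S" and st: "s \<le> t"
    and deg: "(card I - 1) + (card K ^ s - 1) * (card I + (card I - 1)) + d + 2 \<le> card S"
  shows "\<exists>G. (\<forall>j\<in>S - I. G j \<in> carrier R \<rightarrow> ({1..t - s} \<rightarrow>\<^sub>E K)) \<and>
    (\<forall>f f'. polyfun d f \<longrightarrow> polyfun d f' \<longrightarrow> (\<forall>j\<in>S - I. G j (f (\<alpha> j)) = G j (f' (\<alpha> j))) \<longrightarrow>
      (\<forall>i\<in>I. f (\<alpha> i) = f' (\<alpha> i)))"
proof -
  note Kc = subringE(1)[OF subfieldE(1)[OF K]]
  have \<alpha>c: "\<alpha> j \<in> carrier R" if "j \<in> S" for j using \<alpha>(1) that by auto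
  have finI: "finite I" using I finS by (rule finite_subset)
  have \<alpha>I: "\<alpha> i \<in> carrier R" if "i \<in> I" for i using \<alpha>c I that by blast
  have \<alpha>n: "\<alpha> j \<ominus> \<alpha> l \<in> carrier R - {\<zero>}" if "j \<in> S" "l \<in> S" "j \<noteq> l" for j l
    using \<alpha>c[OF that(1)] \<alpha>c[OF that(2)] inj_onD[OF \<alpha>(2) _ that(1,2)] that(3) by auto
  obtain Us where Us: "set Us \<subseteq> carrier R" "length Us = t" "Span K Us = carrier R"
    using exists_base[OF K dim] by auto
  obtain \<phi> x\<^sub>0 where \<phi>: "linear_over K \<phi>" "\<phi> \<in> carrier R \<rightarrow> K" and x\<^sub>0: "x\<^sub>0 \<in> carrier R" "\<phi> x\<^sub>0 \<noteq> \<zero>"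
    using coordinate_functional_exists[OF K dim] by blast
  have "set (take s Us) \<subseteq> carrier R" using Us(1) set_take_subset by fast
  from linearised_polynomial_exists[OF K finK this] obtain M where
    M: "polyfun (card K ^ s - 1) M" "M \<zero> \<noteq> \<zero>" and L: "linear_over K (\<lambda>x. x \<otimes> M x)"
    and LU: "\<And>u. u \<in> set (take s Us) \<Longrightarrow> u \<otimes> M u = \<zero>"
    using Us(2) st by auto
  have Mc: "M x \<in> carrier R" if "x \<in> carrier R" for x using M(1) that by (rule polyfun_closed)
  have "S \<noteq> {}" using deg by auto
  from dual_weights_exist[OF finS this \<alpha>] obtain v where v: "v \<in> S \<rightarrow> carrier R - {\<zero>}"
    and dual: "\<And>d f. polyfun d f \<Longrightarrow> d + 2 \<le> card S \<Longrightarrow> (\<Oplus>j\<in>S. v j \<otimes> f (\<alpha> j)) = \<zero>"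
    by blast
  have vc: "v j \<in> carrier R" if "j \<in> S" for j using v that by auto
  define A where "A = (\<lambda>x. \<Otimes>i\<in>I. (x \<ominus> \<alpha> i))"
  have A: "polyfun (card I) A"
    unfolding A_def by (rule polyfun_finprod[OF finI]) (use \<alpha>I in blast)
  have Ac: "A x \<in> carrier R" if "x \<in> carrier R" for x using A that by (rule polyfun_closed)
  have A0: "A (\<alpha> i) = \<zero>" if "i \<in> I" for i
    unfolding A_def
    by (rule finprod_zero[OF finI _ that]) (use that \<alpha>I in auto)
  have An: "A (\<alpha> j) \<in> Units R" if "j \<in> S - I" for j
  proof -
    have "A (\<alpha> j) \<noteq> \<zero>" unfolding A_def
      by (rule finprod_nonzero[OF finI]) (use that I \<alpha>n in blast)
    then show ?thesis using Ac \<alpha>c that field_Units by auto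
  qed
  define w where "w j = v j \<otimes> inv (A (\<alpha> j))" for j
  have wc: "w j \<in> carrier R" if "j \<in> S - I" for j
    unfolding w_def using that vc An by auto
  define G where "G j x = (\<lambda>m\<in>{1..t - s}. \<phi> (w j \<otimes> x \<otimes> (Us ! (s + m - 1) \<otimes> M (Us ! (s + m - 1)))))"
    for j x
  have Uc: "Us ! (s + m - 1) \<in> carrier R" if "m \<in> {1..t - s}" for m
    using that Us(1,2) nth_mem[of "s + m - 1" Us] by auto
  have "G j \<in> carrier R \<rightarrow> ({1..t - s} \<rightarrow>\<^sub>E K)" if "j \<in> S - I" for j
    unfolding G_def using \<phi>(2) wc[OF that] Uc Mc by (auto simp: Pi_iff)
  moreover have "f (\<alpha> i) = f' (\<alpha> i)"
    if f: "polyfun d f" and f': "polyfun d f'"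
      and eq: "\<And>j. j \<in> S - I \<Longrightarrow> G j (f (\<alpha> j)) = G j (f' (\<alpha> j))" and i: "i \<in> I" for f f' i
  proof -
    define e where "e = (\<lambda>x. f x \<ominus> f' x)"
    have e: "polyfun d e" unfolding e_def by (rule polyfun_minus[OF f f'])
    have ec: "e x \<in> carrier R" if "x \<in> carrier R" for x using e that by (rule polyfun_closed)
    have iS: "i \<in> S" using i I by auto
    \<comment> \<open>The expression is linear in \<open>y\<close>. It vanishes at the first
      \<open>s\<close> basis elements because these are killed, and at the others because the
      symbols sent agree; hence it vanishes on all of the field.\<close>
    have downloaded: "\<phi> (w j \<otimes> e (\<alpha> j) \<otimes> (y \<otimes> M y)) = \<zero>" if j: "j \<in> S - I" and y: "y \<in> carrier R" for j y
    proof -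
      have ej: "e (\<alpha> j) \<in> carrier R" "f (\<alpha> j) \<in> carrier R" "f' (\<alpha> j) \<in> carrier R"
        using ec polyfun_closed[OF f] polyfun_closed[OF f'] \<alpha>c j by auto
      have lin: "linear_over K (\<lambda>y. \<phi> (w j \<otimes> e (\<alpha> j) \<otimes> (y \<otimes> M y)))"
        by (rule linear_over_comp[OF linear_over_comp_smult[OF _ Kc \<phi>(1)] L]) (use wc[OF j] ej in auto)
      show ?thesis
      proof (rule linear_over_Span_zero[OF lin Kc Us(1)])
        show "y \<in> Span K Us" using y Us(3) by simp
        fix u assume "u \<in> set Us"
        then obtain m where m: "m < t" "u = Us ! m" using Us(2) by (auto simp: in_set_conv_nth)
        have uc: "u \<in> carrier R" using \<open>u \<in> set Us\<close> Us(1) by auto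
        show "\<phi> (w j \<otimes> e (\<alpha> j) \<otimes> (u \<otimes> M u)) = \<zero>"
        proof (cases "m < s")
          case True
          then have "u \<in> set (take s Us)" using m Us(2) st by (auto simp: in_set_conv_nth)
          then show ?thesis using LU wc[OF j] ej linear_over_zero[OF \<phi>(1)] by simp
        next
          case False
          then have idx: "Suc (m - s) \<le> t - s" "s + Suc (m - s) - Suc 0 = m" using m(1) by auto
          have "G j (f (\<alpha> j)) (m - s + 1) = G j (f' (\<alpha> j)) (m - s + 1)" using eq[OF j] by simp
          then have "\<phi> (w j \<otimes> f (\<alpha> j) \<otimes> (u \<otimes> M u)) = \<phi> (w j \<otimes> f' (\<alpha> j) \<otimes> (u \<otimes> M u))"
            unfolding G_def m(2) using idx by simp
          moreover have "w j \<otimes> e (\<alpha> j) \<otimes> (u \<otimes> M u) =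
              w j \<otimes> f (\<alpha> j) \<otimes> (u \<otimes> M u) \<ominus> w j \<otimes> f' (\<alpha> j) \<otimes> (u \<otimes> M u)"
            unfolding e_def using wc[OF j] ej(2,3) uc Mc[OF uc] by algebra
          ultimately show ?thesis
            using linear_over_minus[OF \<phi>(1)] linear_over_closed[OF \<phi>(1)] wc[OF j] ej uc Mc[OF uc]
            by (simp add: minus_eq r_neg)
        qed
      qed
    qed
    define D where "D = (\<Otimes>l\<in>I - {i}. (\<alpha> i \<ominus> \<alpha> l))"
    have Dn: "D \<noteq> \<zero>" unfolding D_def
      by (rule finprod_nonzero) (use i finI I \<alpha>n in blast)+
    have Dc: "D \<in> carrier R" unfolding D_def
      by (rule finprod_closed) (use i \<alpha>I in auto)
    have recover: "\<phi> (v i \<otimes> (z \<otimes> D \<otimes> M \<zero> \<otimes> e (\<alpha> i))) = \<zero>" if z: "z \<in> carrier R" for z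
    proof -
      \<comment> \<open>This choice separates the failed nodes: \<open>h\<close> vanishes at all of
        them except \<open>i\<close>, where it takes the value \<open>z \<otimes> D\<close> with
        \<open>D\<close> nonzero and \<open>z\<close> free.\<close>
      define h where "h = (\<lambda>x. z \<otimes> (\<Otimes>l\<in>I - {i}. (x \<ominus> \<alpha> l)))"
      have "polyfun (card (I - {i})) h"
        unfolding h_def by (intro polyfun_smult polyfun_finprod z) (use finI \<alpha>I in auto)
      then have h: "polyfun (card I - 1) h" using i finI by simp
      have hc: "h x \<in> carrier R" if "x \<in> carrier R" for x using h that by (rule polyfun_closed)
      have hi: "h (\<alpha> i) = z \<otimes> D" unfolding h_def D_def ..
      have h0: "h (\<alpha> l) = \<zero>" if "l \<in> I - {i}" for l
      proof -
        have "(\<Otimes>m\<in>I - {i}. (\<alpha> l \<ominus> \<alpha> m)) = \<zero>"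
          by (rule finprod_zero[OF _ _ that]) (use that finI \<alpha>I in auto)
        then show ?thesis unfolding h_def using z by simp
      qed
      define P where "P = (\<lambda>x. h x \<otimes> M (A x \<otimes> h x))"
      have P: "polyfun ((card I - 1) + (card K ^ s - 1) * (card I + (card I - 1))) P"
        unfolding P_def by (intro polyfun_mult h polyfun_comp[OF M(1)] A)
      have Pc: "P x \<in> carrier R" if "x \<in> carrier R" for x using P that by (rule polyfun_closed)
      have Pe: "polyfun ((card I - 1) + (card K ^ s - 1) * (card I + (card I - 1)) + d) (\<lambda>x. P x \<otimes> e x)"
        by (rule polyfun_mult[OF P e])
      have tc: "v j \<otimes> (P (\<alpha> j) \<otimes> e (\<alpha> j)) \<in> carrier R" if "j \<in> S" for j
        using that vc Pc ec \<alpha>c by auto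
      have Pi: "P (\<alpha> i) = z \<otimes> D \<otimes> M \<zero>"
        unfolding P_def using A0[OF i] hi hc \<alpha>c[OF iS] z Dc by simp
      \<comment> \<open>At another failed node \<open>h\<close> vanishes. At a surviving node v P =
        w L(A h), so \<open>downloaded\<close> applies with y = A h.\<close>
      have t0: "\<phi> (v j \<otimes> (P (\<alpha> j) \<otimes> e (\<alpha> j))) = \<zero>" if j: "j \<in> S" "j \<noteq> i" for j
      proof (cases "j \<in> I")
        case True
        then have "P (\<alpha> j) = \<zero>"
          unfolding P_def using h0[of j] j Mc Ac \<alpha>c by simp
        then show ?thesis using ec \<alpha>c vc j linear_over_zero[OF \<phi>(1)] by simp
      next
        case False
        let ?a = "A (\<alpha> j)"
        have c: "\<alpha> j \<in> carrier R" "?a \<in> carrier R" "inv ?a \<in> carrier R" "h (\<alpha> j) \<in> carrier R"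
          "e (\<alpha> j) \<in> carrier R" "v j \<in> carrier R" "M (?a \<otimes> h (\<alpha> j)) \<in> carrier R"
          using j False \<alpha>c Ac An hc ec vc Mc by auto
        have "v j \<otimes> (x \<otimes> m \<otimes> e (\<alpha> j)) = v j \<otimes> inv ?a \<otimes> e (\<alpha> j) \<otimes> (?a \<otimes> x \<otimes> m)"
          if "x \<in> carrier R" "m \<in> carrier R" for x m
        proof -
          have "v j \<otimes> inv ?a \<otimes> e (\<alpha> j) \<otimes> (?a \<otimes> x \<otimes> m) =
              (inv ?a \<otimes> ?a) \<otimes> (v j \<otimes> (x \<otimes> m \<otimes> e (\<alpha> j)))"
            using that c(2,3,5,6) by algebra
          then show ?thesis using that c An[of j] j False by simp
        qed
        from this[OF c(4,7)] show ?thesis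
          using downloaded[of j "?a \<otimes> h (\<alpha> j)"] j False c unfolding P_def w_def by simp
      qed
      \<comment> \<open>The product P e is within the range of the dual relation by
        \<open>deg\<close>. After applying \<open>\<phi>\<close> only the term at \<open>i\<close>
        is left.\<close>
      have "\<zero> = \<phi> (\<Oplus>j\<in>S. v j \<otimes> (P (\<alpha> j) \<otimes> e (\<alpha> j)))"
        using dual[OF Pe deg] linear_over_zero[OF \<phi>(1)] by simp
      also have "\<dots> = (\<Oplus>j\<in>S. \<phi> (v j \<otimes> (P (\<alpha> j) \<otimes> e (\<alpha> j))))"
        by (rule linear_over_finsum[OF \<phi>(1) finS]) (use tc in auto)
      also have "\<dots> = (\<Oplus>j\<in>S. if i = j then \<phi> (v j \<otimes> (P (\<alpha> j) \<otimes> e (\<alpha> j))) else \<zero>)"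
        by (rule add.finprod_cong') (use t0 tc linear_over_closed[OF \<phi>(1)] in auto)
      also have "\<dots> = \<phi> (v i \<otimes> (P (\<alpha> i) \<otimes> e (\<alpha> i)))"
        by (rule add.finprod_singleton[OF iS finS])
          (use tc linear_over_closed[OF \<phi>(1)] in auto)
      finally show ?thesis unfolding Pi by simp
    qed
    \<comment> \<open>Now \<phi>(z y) = 0 for every \<open>z\<close>. If \<open>y\<close> were
      nonzero, the choice z = x0 / y would give \<phi>(x0) = 0, against the choice of x0.\<close>
    define y where "y = v i \<otimes> D \<otimes> M \<zero> \<otimes> e (\<alpha> i)"
    have c: "v i \<in> carrier R" "M \<zero> \<in> carrier R" "e (\<alpha> i) \<in> carrier R"
      using vc iS Mc ec \<alpha>c by auto
    have yc: "y \<in> carrier R" unfolding y_def using c Dc by auto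
    have "y = \<zero>"
    proof (rule ccontr)
      assume "y \<noteq> \<zero>"
      then have yU: "y \<in> Units R" using yc field_Units by auto
      have ic: "inv y \<in> carrier R" using yU by simp
      have "v i \<otimes> (x\<^sub>0 \<otimes> inv y \<otimes> D \<otimes> M \<zero> \<otimes> e (\<alpha> i)) = x\<^sub>0 \<otimes> (inv y \<otimes> y)"
      proof -
        have "v i \<otimes> (x\<^sub>0 \<otimes> u \<otimes> D \<otimes> M \<zero> \<otimes> e (\<alpha> i)) = x\<^sub>0 \<otimes> (u \<otimes> y)" if "u \<in> carrier R" for u
          unfolding y_def using that c Dc x\<^sub>0(1) by algebra
        then show ?thesis using ic by blast
      qed
      also have "\<dots> = x\<^sub>0" using yU x\<^sub>0(1) by simp
      finally show False using recover[of "x\<^sub>0 \<otimes> inv y"] x\<^sub>0 ic by simp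
    qed
    then have "e (\<alpha> i) = \<zero>"
      using c Dc Dn M(2) v iS unfolding y_def by (auto simp: integral_iff Pi_iff)
    then show ?thesis
      unfolding e_def using polyfun_closed[OF f] polyfun_closed[OF f'] \<alpha>c[OF iS] by simp
  qed
  ultimately show ?thesis by blast
qed

section \<open>Repairing Reed-Solomon codewords\<close>

lemma reed_solomon_codewordE:
  assumes "field F" "c \<in> reed_solomon_code F n k \<alpha>"
  obtains f where "ring.polyfun F (k - 1) f" "\<And>i. i \<in> {1..n} \<Longrightarrow> c i = f (\<alpha> i)"
proof -
  interpret field F by fact
  obtain p where p: "c = (\<lambda>i\<in>{1..n}. eval p (\<alpha> i))" "p \<in> carrier (poly_ring F)" "degree p < k"
    using assms(2) unfolding reed_solomon_code_def by blast
  have "set p \<subseteq> carrier F"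
    using p(2) polynomial_in_carrier[OF carrier_is_subring] by (simp add: univ_poly_carrier)
  then have "polyfun (k - 1) (eval p)"
    using p(3) by (intro polyfun_mono[OF polyfun_eval]) auto
  then show ?thesis using that p(1) by simp
qed

text \<open>Repairing any \<open>r'\<close> failures also repairs a smaller failed set \<open>I\<close>: enlarge \<open>I\<close> to \<open>J I\<close> of size
  \<open>r'\<close> and download nothing from the nodes added.\<close>

lemma repair_scheme_exists:
  fixes F :: "('a, 'm) ring_scheme" and B :: "'a set"
    and n k r r' s t :: nat and \<alpha> :: "nat \<Rightarrow> 'a"
  assumes F: "field F" and B: "subfield B F" "finite B" and dim: "ring.dimension F t B (carrier F)"
    and \<alpha>: "\<alpha> \<in> {1..n} \<rightarrow> carrier F" "inj_on \<alpha> {1..n}"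
    and k: "1 \<le> k" and r: "1 \<le> r" "r \<le> r'" "r' + k \<le> n"
    and st: "s \<le> t" and deg: "card B ^ s * (2 * r' - 1) + k + 1 \<le> n + r'"
  shows "\<exists>b g. exact_centralized_repair_scheme F B n r (reed_solomon_code F n k \<alpha>) b g \<and>
    repair_bandwidth n r b \<le> (n - r') * (t - s)"
proof -
  interpret field F by fact
  have "card B > 0"
    using B subringE(2)[OF subfieldE(1)[OF B(1)]] by (metis card_gt_0_iff empty_iff)
  then have "card B ^ s > 0" by simp
  then obtain q where q: "card B ^ s = Suc q" by (cases "card B ^ s") auto
  obtain a where a: "r' = Suc a" using r by (cases r') auto
  \<comment> \<open>With Q = |B|^s the left side equals Q (2 r' - 1) - r' + k + 1, so this is
    \<open>deg\<close> rearranged. Successor forms avoid truncated subtraction.\<close>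
  have deg': "(r' - 1) + (card B ^ s - 1) * (r' + (r' - 1)) + (k - 1) + 2 \<le> card {1..n}"
    using deg k unfolding q a by (simp add: algebra_simps)
  let ?small = "\<lambda>I. I \<subseteq> {1..n} \<and> card I \<le> r"
  define good where "good I J G \<longleftrightarrow> I \<subseteq> J \<and> J \<subseteq> {1..n} \<and> card J = r' \<and>
      (\<forall>j\<in>{1..n} - J. G j \<in> carrier F \<rightarrow> ({1..t - s} \<rightarrow>\<^sub>E B)) \<and>
      (\<forall>f f'. polyfun (k - 1) f \<longrightarrow> polyfun (k - 1) f' \<longrightarrow>
        (\<forall>j\<in>{1..n} - J. G j (f (\<alpha> j)) = G j (f' (\<alpha> j))) \<longrightarrow> (\<forall>i\<in>J. f (\<alpha> i) = f' (\<alpha> i)))"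
    for I J and G :: "nat \<Rightarrow> 'a \<Rightarrow> nat \<Rightarrow> 'a"
  have "\<exists>J G. good I J G" if I: "?small I" for I
  proof -
    obtain J where J: "I \<subseteq> J" "J \<subseteq> {1..n}" "card J = r'"
      using exists_subset_between[of I r' "{1..n}"] I r by auto
    show ?thesis
      unfolding good_def using repair_functions_exist[OF B dim _ \<alpha> J(2) st deg'[folded J(3)]] J
      by blast
  qed
  then obtain J G where good: "\<And>I. ?small I \<Longrightarrow> good I (J I) (G I)" by metis
  have J: "I \<subseteq> J I \<and> J I \<subseteq> {1..n} \<and> card (J I) = r'" if "?small I" for I
    using good[OF that] unfolding good_def by blast
  have G: "G I j \<in> carrier F \<rightarrow> ({1..t - s} \<rightarrow>\<^sub>E B)" if "?small I" "j \<in> {1..n} - J I" for I j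
    using good[OF that(1)] that(2) unfolding good_def by blast
  have rep: "\<forall>i\<in>J I. f (\<alpha> i) = f' (\<alpha> i)"
    if "?small I" "polyfun (k - 1) f" "polyfun (k - 1) f'"
      "\<forall>j\<in>{1..n} - J I. G I j (f (\<alpha> j)) = G I j (f' (\<alpha> j))" for I f f'
    using good[OF that(1)] that(2-) unfolding good_def by blast
  define b where "b = (\<lambda>I j. if j \<in> J I then 0 else t - s)"
  \<comment> \<open>The constant \<open>\<lambda>_. undefined\<close> is the empty word, the only
    element of \<open>{1..0} \<rightarrow>\<^sub>E B\<close>.\<close>
  define g where "g = (\<lambda>I j x. if j \<in> J I then \<lambda>_. undefined else G I j x)"
  have "exact_centralized_repair_scheme F B n r (reed_solomon_code F n k \<alpha>) b g"
    unfolding exact_centralized_repair_scheme_def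
  proof (intro allI impI conjI ballI)
    fix I j assume "?small I" "j \<in> {1..n} - I"
    then show "g I j \<in> carrier F \<rightarrow> ({1..b I j} \<rightarrow>\<^sub>E B)"
      using G[of I j] unfolding b_def g_def by (cases "j \<in> J I") auto
  next
    fix I c c' i
    assume I: "?small I" and c: "c \<in> reed_solomon_code F n k \<alpha>" "c' \<in> reed_solomon_code F n k \<alpha>"
      and i: "i \<in> I" and eq: "\<forall>j\<in>{1..n} - I. g I j (c j) = g I j (c' j)"
    obtain f where f: "polyfun (k - 1) f" "\<And>i. i \<in> {1..n} \<Longrightarrow> c i = f (\<alpha> i)"
      using reed_solomon_codewordE[OF F c(1)] by blast
    obtain f' where f': "polyfun (k - 1) f'" "\<And>i. i \<in> {1..n} \<Longrightarrow> c' i = f' (\<alpha> i)"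
      using reed_solomon_codewordE[OF F c(2)] by blast
    have "G I j (f (\<alpha> j)) = G I j (f' (\<alpha> j))" if j: "j \<in> {1..n} - J I" for j
    proof -
      have "g I j (c j) = g I j (c' j)" using eq j J[OF I] by auto
      then show ?thesis using j f(2) f'(2) unfolding g_def by simp
    qed
    then have "f (\<alpha> i) = f' (\<alpha> i)" using rep[OF I f(1) f'(1)] i J[OF I] by blast
    then show "c i = c' i" using f(2) f'(2) i I by auto
  qed
  \<comment> \<open>The cost is the same for every failed set, so the maximum defining the bandwidth
    is taken over a singleton.\<close>
  moreover have sums: "(\<Sum>j\<in>{1..n} - I. b I j) = (n - r') * (t - s)" if I: "?small I" for I
  proof -
    have "(\<Sum>j\<in>{1..n} - I. b I j) = (\<Sum>j\<in>{1..n} - J I. b I j)"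
      by (rule sum.mono_neutral_right) (use J[OF I] in \<open>auto simp: b_def\<close>)
    also have "\<dots> = (\<Sum>j\<in>{1..n} - J I. t - s)" by (rule sum.cong) (auto simp: b_def)
    also have "\<dots> = (n - r') * (t - s)"
      using J[OF I] finite_subset[of "J I" "{1..n}"] by (simp add: card_Diff_subset)
    finally show ?thesis .
  qed
  have "?small {}" by simp
  then have "{(\<Sum>j\<in>{1..n} - I. b I j) | I. ?small I} = {(n - r') * (t - s)}"
    using sums sums[symmetric] by blast
  then have "repair_bandwidth n r b = (n - r') * (t - s)"
    unfolding repair_bandwidth_def by simp
  ultimately show ?thesis by auto
qed

section \<open>Choice of the parameters r' and s\<close>

theorem theorem2:
  fixes F :: "('a, 'm) ring_scheme" and B :: "'a set"
    and n k r t :: nat and \<alpha> :: "nat \<Rightarrow> 'a"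
  assumes "field F" and "finite (carrier F)"
    and "subfield B F" and "ring.dimension F t B (carrier F)"
    and "\<alpha> \<in> {1..n} \<rightarrow> carrier F" and "inj_on \<alpha> {1..n}"
    and "1 \<le> k" and "k \<le> n"
    and "1 \<le> r" and "r \<le> n - k"
  shows "\<exists>b g. exact_centralized_repair_scheme F B n r (reed_solomon_code F n k \<alpha>) b g \<and>
    int (repair_bandwidth n r b) \<le>
      Min ((\<lambda>r'. (int n - int r') *
              (int t - \<lfloor>log (real (card B))
                          ((real n - real k + real r' - 1) / (2 * real r' - 1))\<rfloor>)) ` {r..n - k})"
    (is "\<exists>b g. _ \<and> _ \<le> Min (?bound ` _)")
proof -
  interpret field F by fact
  note Bc = subringE[OF subfieldE(1)[OF assms(3)]]
  have finB: "finite B" using Bc(1) assms(2) by (rule finite_subset)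
  \<comment> \<open>The minimum is attained, so one scheme, built for a minimising r', is
    enough.\<close>
  have "Min (?bound ` {r..n - k}) \<in> ?bound ` {r..n - k}"
    by (rule Min_in) (use assms in auto)
  then obtain r' where r': "r \<le> r'" "r' \<le> n - k" "Min (?bound ` {r..n - k}) = ?bound r'" by auto
  define x where "x = (real n - real k + real r' - 1) / (2 * real r' - 1)"
  define s where "s = nat \<lfloor>log (real (card B)) x\<rfloor>"
  have "card {\<zero>\<^bsub>F\<^esub>, \<one>\<^bsub>F\<^esub>} \<le> card B" by (rule card_mono[OF finB]) (use Bc in auto)
  then have q: "card B \<ge> 2" by simp
  have real_r': "real r' \<ge> 1" "real r' \<le> real n - real k" using r' assms by auto
  \<comment> \<open>Equivalent to r' \<le> n - k. It makes the logarithm nonnegative, so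
    \<open>nat\<close> loses nothing in the definition of \<open>s\<close>.\<close>
  then have x: "x \<ge> 1" unfolding x_def by (simp add: field_simps)
  then have "log (real (card B)) x \<ge> 0" using q by simp
  then have s: "int s = \<lfloor>log (real (card B)) x\<rfloor>" unfolding s_def by simp
  then have "real s \<le> log (real (card B)) x" by linarith
  then have "real (card B) powr real s \<le> x" using q x by (simp add: le_log_iff)
  then have "real (card B ^ s) \<le> x" using q by (simp add: powr_realpow)
  \<comment> \<open>Clearing the positive denominator 2 r' - 1 turns the choice of \<open>s\<close>
    into the degree condition of the scheme.\<close>
  then have "real (card B ^ s) * (2 * real r' - 1) \<le> real n - real k + real r' - 1"
    using real_r' unfolding x_def by (simp add: field_simps)
  moreover have "2 * real r' - 1 = real (2 * r' - 1)" using real_r' by (simp add: of_nat_diff)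
  ultimately have "real (card B ^ s * (2 * r' - 1)) \<le> real n - real k + real r' - 1"
    by (simp only: of_nat_mult)
  then have "real (card B ^ s * (2 * r' - 1) + k + 1) \<le> real (n + r')"
    unfolding of_nat_add of_nat_1 by linarith
  then have deg: "card B ^ s * (2 * r' - 1) + k + 1 \<le> n + r'" by (simp only: of_nat_le_iff)
  \<comment> \<open>The degree condition gives |B|^s \<le> n, and distinct evaluation points give n
    \<le> |F| \<le> |B|^t. Hence the truncated \<open>t - s\<close> agrees with the integer
    difference in the bound.\<close>
  have "s \<le> t"
  proof -
    obtain a where a: "r' = Suc a" using r' assms(9) by (cases r') auto
    have "card B ^ s \<ge> 1" using q by simp
    then have "1 * (2 * a) \<le> card B ^ s * (2 * a)" by (rule mult_le_mono1)
    moreover have "card B ^ s * (2 * Suc a - 1) = card B ^ s * (2 * a) + card B ^ s" by simp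
    ultimately have "card B ^ s \<le> n" using deg unfolding a by linarith
    also have "n \<le> card (carrier F)"
      using card_inj_on_le[OF assms(6), of "carrier F"] assms(2,5) by auto
    also have "\<dots> \<le> card B ^ t"
    proof -
      obtain Us where "length Us = t" "Span B Us = carrier F"
        using exists_base[OF assms(3,4)] by auto
      then show ?thesis using card_Span_le[OF finB, of Us] by simp
    qed
    finally show ?thesis using q by (simp add: power_le_imp_le_exp)
  qed
  have "r' + k \<le> n" using r'(2) assms(8) by simp
  from repair_scheme_exists[OF assms(1,3) finB assms(4-7,9) r'(1) this \<open>s \<le> t\<close> deg]
  obtain b g where
    bg: "exact_centralized_repair_scheme F B n r (reed_solomon_code F n k \<alpha>) b g"
      "repair_bandwidth n r b \<le> (n - r') * (t - s)"
    by blast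
  have "int (repair_bandwidth n r b) \<le> int ((n - r') * (t - s))"
    using bg(2) by (simp only: of_nat_le_iff)
  also have "\<dots> = (int n - int r') * (int t - int s)"
    using \<open>s \<le> t\<close> r'(2) by (simp add: of_nat_diff)
  also have "\<dots> = Min (?bound ` {r..n - k})" unfolding r'(3) s x_def ..
  finally show ?thesis using bg(1) by blast
qed

end
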